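(* For every integer $i\ge0$ and all $t\ne0$, $$\biggl(\frac1{1-e^{-t}}\biggr)^{(i)}=\sum_{m=1}^{i+1}\frac{\mu_{i,m}}{(1-e^{-t})^m},$$ where $\mu_{i,m}=(-1)^{m+1}(m-1)!\,S(i+1,m)$ for $1\le m\le i+1$.
   Context: $t$ is a real variable. For a function $f$ of $t$, $f^{(n)}$ denotes the $n$-th derivative with respect to $t$, with $f^{(0)}=f$. For $1\le m\le n$, $S(n,m)=\frac1{m!}\sum_{\ell=0}^m(-1)^{m-\ell}\binom{m}{\ell}\ell^{n}$ are the Stirling numbers of the second kind. *)

theory Defs
  imports "HOL-Analysis.Analysis" "HOL-Combinatorics.Stirling"
begin

text \<open>
  The Stirling numbers of the second kind are the library's \<^const>\<open>Stirling\<close>, which is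
  defined by the triangular recurrence; the following lemma is their explicit formula as an
  alternating binomial sum.
\<close>

lemma Stirling_explicit:
  "real (Stirling n m) =
     1 / fact m * (\<Sum>l=0..m. (-1) ^ (m - l) * real (m choose l) * real l ^ n)"
proof -
  have "fact m * real (Stirling n m) =
          (\<Sum>l\<le>m. (-1) ^ (m - l) * real (m choose l) * real l ^ n)"
  proof (induction n arbitrary: m)
    case 0
    have "(\<Sum>l\<le>m. (-1) ^ (m - l) * real (m choose l)) = (1 + (-1)) ^ m"
      by (subst binomial_ring) (simp add: mult.commute)
    then show ?case
      by (cases m) simp_all
  next
    case (Suc n)
    show ?case
    proof (cases m)
      case 0
      then show ?thesis by simp
    next
      case (Suc k)
      have absorb: "real l * real (Suc k choose l) =
          real (Suc k) * real (Suc k choose l) - real (Suc k) * real (k choose l)"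
        if "l \<le> Suc k" for l
      proof -
        have "real (Suc k - l) * real (Suc k choose l) = real (Suc k) * real (k choose l)"
          using binomial_absorb_comp[of "Suc k" l] by (metis diff_Suc_1 of_nat_mult)
        then show ?thesis
          using that by (simp add: of_nat_diff algebra_simps)
      qed
      have "(\<Sum>l\<le>Suc k. (-1) ^ (Suc k - l) * real (Suc k choose l) * real l ^ Suc n) =
            (\<Sum>l\<le>Suc k. (-1) ^ (Suc k - l) * (real l * real (Suc k choose l)) * real l ^ n)"
        by (simp only: power_Suc mult_ac)
      also have "\<dots> = (\<Sum>l\<le>Suc k.
              real (Suc k) * ((-1) ^ (Suc k - l) * real (Suc k choose l) * real l ^ n)
            - real (Suc k) * ((-1) ^ (Suc k - l) * real (k choose l) * real l ^ n))"
        by (intro sum.cong refl, subst absorb) (simp_all only: atMost_iff algebra_simps)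
      also have "\<dots> =
              real (Suc k) * (\<Sum>l\<le>Suc k. (-1) ^ (Suc k - l) * real (Suc k choose l) * real l ^ n)
            - real (Suc k) * (\<Sum>l\<le>Suc k. (-1) ^ (Suc k - l) * real (k choose l) * real l ^ n)"
        by (simp only: sum_subtractf sum_distrib_left)
      also have "(\<Sum>l\<le>Suc k. (-1) ^ (Suc k - l) * real (k choose l) * real l ^ n) =
            - (\<Sum>l\<le>k. (-1) ^ (k - l) * real (k choose l) * real l ^ n)"
        by (simp add: Suc_diff_le sum_negf)
      finally show ?thesis
        using Suc.IH[of "Suc k"] Suc.IH[of k] \<open>m = Suc k\<close> by (simp add: algebra_simps)
    qed
  qed
  then show ?thesis
    by (simp add: atLeast0AtMost field_simps)
qed

definition mu :: "nat \<Rightarrow> nat \<Rightarrow> real" where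
  "mu i m = (-1) ^ (m + 1) * fact (m - 1) * real (Stirling (i + 1) m)"

end

theory Submission
  imports Defs
begin

text \<open>
  The function \<open>y(t) = 1 / (1 - exp (- t))\<close> solves the logistic equation \<open>y' = y - y\<^sup>2\<close> on
  the punctured line, so \<open>(y\<^sup>m)' = m y\<^sup>m - m y\<^bsup>m+1\<^esup>\<close>: differentiation acts on polynomials
  in \<open>y\<close>. On coefficients it sends \<open>c\<close> to \<open>m c\<^sub>m - (m - 1) c\<^bsub>m-1\<^esub>\<close>, and the
  triangular recurrence of the Stirling numbers, once rescaled by the signed factorials, says
  exactly that the coefficients \<open>mu\<close> obey this rule in their first index
  (\<open>mu_Suc_Suc\<close>). Since the punctured line is open, the pointwise derivatives may be iterated
  (\<open>deriv_funpow_eq_on_open\<close>).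
\<close>

lemma mu_Suc_Suc: "mu (Suc i) (Suc k) = real (Suc k) * mu i (Suc k) - real k * mu i k"
  by (cases k) (simp_all add: mu_def algebra_simps)

lemma mu_eq_0: "Suc i < m \<Longrightarrow> mu i m = 0"
  by (simp add: mu_def)

text \<open>
  The iterated derivative and \<open>F n\<close> may differ outside \<open>S\<close>, where nothing is known about
  differentiability. Since \<open>S\<close> is open, agreement on \<open>S\<close> is agreement near each of its points,
  which is what differentiating once more requires.
\<close>

lemma deriv_funpow_eq_on_open:
  fixes F :: "nat \<Rightarrow> 'a::real_normed_field \<Rightarrow> 'a"
  assumes "open S"
    and F: "\<And>n x. x \<in> S \<Longrightarrow> (F n has_field_derivative F (Suc n) x) (at x)"
    and "x \<in> S"
  shows "(deriv ^^ n) (F 0) x = F n x"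
    and "(deriv ^^ n) (F 0) field_differentiable (at x)"
proof -
  have eq: "(deriv ^^ n) (F 0) x = F n x" if "x \<in> S" for n x
    using that
  proof (induction n arbitrary: x)
    case (Suc n)
    have "((deriv ^^ n) (F 0) has_field_derivative F (Suc n) x) (at x)"
      by (rule has_field_derivative_transform_within_open[OF F[OF Suc.prems] \<open>open S\<close> Suc.prems])
         (simp add: Suc.IH)
    then show ?case
      by (simp add: DERIV_imp_deriv)
  qed simp
  then show "(deriv ^^ n) (F 0) x = F n x"
    using \<open>x \<in> S\<close> .
  have "((deriv ^^ n) (F 0) has_field_derivative F (Suc n) x) (at x)"
    by (rule has_field_derivative_transform_within_open[OF F[OF \<open>x \<in> S\<close>] \<open>open S\<close> \<open>x \<in> S\<close>])
       (simp add: eq)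
  then show "(deriv ^^ n) (F 0) field_differentiable (at x)"
    by (auto simp: field_differentiable_def)
qed

lemma DERIV_logistic:
  fixes t :: real
  defines "y \<equiv> \<lambda>t::real. 1 / (1 - exp (- t))"
  assumes "t \<noteq> 0"
  shows "(y has_field_derivative y t - y t ^ 2) (at t)"
proof -
  define s where "s = 1 - exp (- t)"
  have "s \<noteq> 0"
    using assms by (simp add: s_def)
  have "(y has_field_derivative - exp (- t) / s ^ 2) (at t)"
    using \<open>s \<noteq> 0\<close> unfolding y_def s_def
    by (auto intro!: derivative_eq_intros simp: power2_eq_square)
  also have "- exp (- t) / s ^ 2 = (s - 1) / s ^ 2"
    by (simp add: s_def)
  also have "\<dots> = 1 / s - (1 / s) ^ 2"
    using \<open>s \<noteq> 0\<close> by (simp add: field_simps power2_eq_square)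
  finally show ?thesis
    by (simp add: y_def s_def)
qed

text \<open>
  Differentiating the \<open>i\<close>-th polynomial termwise produces the two sums \<open>\<Sum> m mu\<^sub>i\<^sub>m y\<^sup>m\<close> and
  \<open>\<Sum> m mu\<^sub>i\<^sub>m y\<^bsup>m+1\<^esup>\<close>; shifting the index of the second one aligns the powers, and the
  recurrence for \<open>mu\<close> merges them.
\<close>

lemma DERIV_mu_polynomial:
  fixes y :: "real \<Rightarrow> real"
  assumes y: "(y has_field_derivative y t - y t ^ 2) (at t)"
  shows "((\<lambda>t. \<Sum>m=1..i+1. mu i m * y t ^ m) has_field_derivative
           (\<Sum>m=1..Suc i+1. mu (Suc i) m * y t ^ m)) (at t)"
proof -
  define c where "c = (\<lambda>m. real m * mu i m)"
  have pow: "((\<lambda>t. mu i m * y t ^ m) has_field_derivative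
               c m * y t ^ m - c m * y t ^ Suc m) (at t)" for m
  proof -
    have "((\<lambda>t. mu i m * y t ^ m) has_field_derivative
            mu i m * (real m * ((y t - y t ^ 2) * y t ^ (m - Suc 0)))) (at t)"
      using DERIV_cmult[OF DERIV_power[OF y]] .
    also have "mu i m * (real m * ((y t - y t ^ 2) * y t ^ (m - Suc 0))) =
                 c m * y t ^ m - c m * y t ^ Suc m"
      by (cases m) (simp_all add: c_def algebra_simps power2_eq_square)
    finally show ?thesis .
  qed
  have "((\<lambda>t. \<Sum>m=1..i+1. mu i m * y t ^ m) has_field_derivative
          (\<Sum>m=1..i+1. c m * y t ^ m - c m * y t ^ Suc m)) (at t)"
    by (rule DERIV_sum) (rule pow)
  also have "(\<Sum>m=1..i+1. c m * y t ^ m - c m * y t ^ Suc m) =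
          (\<Sum>m=1..i+1. c m * y t ^ m) - (\<Sum>m=1..i+1. c m * y t ^ Suc m)"
    by (rule sum_subtractf)
  \<comment> \<open>The new top term of the first sum vanishes because the Stirling number does, and the new
      bottom term of the second because of the factor \<open>m = 0\<close>.\<close>
  also have "(\<Sum>m=1..i+1. c m * y t ^ m) = (\<Sum>k=0..i+1. c (Suc k) * y t ^ Suc k)"
    by (simp add: sum.atLeast1_atMost_eq atLeast0AtMost lessThan_Suc_atMost[symmetric] c_def mu_eq_0)
  also have "(\<Sum>m=1..i+1. c m * y t ^ Suc m) = (\<Sum>k=0..i+1. c k * y t ^ Suc k)"
    by (subst (2) sum.atLeast_Suc_atMost) (simp_all add: c_def)
  also have "(\<Sum>k=0..i+1. c (Suc k) * y t ^ Suc k) - (\<Sum>k=0..i+1. c k * y t ^ Suc k) =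
               (\<Sum>k=0..i+1. mu (Suc i) (Suc k) * y t ^ Suc k)"
    by (simp only: sum_subtractf[symmetric] mu_Suc_Suc c_def left_diff_distrib)
  also have "\<dots> = (\<Sum>m=1..Suc i+1. mu (Suc i) m * y t ^ m)"
    by (simp only: sum.shift_bounds_cl_Suc_ivl One_nat_def add_Suc)
  finally show ?thesis .
qed

theorem lemma2p2:
  fixes i :: nat and f :: "real \<Rightarrow> real"
  defines "f \<equiv> \<lambda>t. 1 / (1 - exp (- t))"
  shows "\<forall>t. t \<noteq> 0 \<longrightarrow>
           (\<forall>j<i. (deriv ^^ j) f field_differentiable (at t)) \<and>
           (deriv ^^ i) f t = (\<Sum>m=1..i+1. mu i m / (1 - exp (- t)) ^ m)"
proof (intro allI impI)
  fix t :: real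
  assume "t \<noteq> 0"
  define F where "F = (\<lambda>n t. \<Sum>m=1..n+1. mu n m * f t ^ m)"
  have F0: "F 0 = f"
    by (simp add: F_def mu_def)
  have F: "(F n has_field_derivative F (Suc n) x) (at x)" if "x \<in> - {0}" for n x
    unfolding F_def by (rule DERIV_mu_polynomial) (use that DERIV_logistic in \<open>simp add: f_def\<close>)
  have "open (- {0::real})"
    by auto
  note iter = deriv_funpow_eq_on_open[of "- {0}" F t, OF this F, unfolded F0]
  have "F i t = (\<Sum>m=1..i+1. mu i m / (1 - exp (- t)) ^ m)"
    by (simp add: F_def f_def power_divide)
  with iter \<open>t \<noteq> 0\<close>
  show "(\<forall>j<i. (deriv ^^ j) f field_differentiable (at t)) \<and>
        (deriv ^^ i) f t = (\<Sum>m=1..i+1. mu i m / (1 - exp (- t)) ^ m)"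
    by simp
qed

end
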